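(* Let $f_1=\sin\theta\cos\phi$, $f_2=\sin\theta\sin\phi$, $f_3=\cos\theta$ on the unit sphere $S^2$, and let $F_1=X_1f_1+Y_1f_2+Z_1f_3$ and $F_2=X_2f_1+Y_2f_2+Z_2f_3$, with real coefficients, be two non zero functions. If $F_1\cdot F_2:=X_1X_2+Y_1Y_2+Z_1Z_2=0$, then the great circles $\{F_1=0\}$ and $\{F_2=0\}$ on the sphere meet orthogonally.
   Context: $S^2=\{x^2+y^2+z^2=1\}\subset\mathbb{R}^3$ with coordinates $x=\sin\theta\cos\phi$, $y=\sin\theta\sin\phi$, $z=\cos\theta$, and with the metric $ds^2=d\theta^2+\sin^2\theta\,d\phi^2$ induced by the Euclidean metric. Orthogonality of curves at a common point means orthogonality of their tangent vectors with respect to this metric. *)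

theory Defs
  imports "HOL-Analysis.Analysis"
begin

text \<open>
  The unit sphere is the library's sphere 0 1 in \<real>^3, with the metric induced by the
  Euclidean inner product.  The angles range over all reals: every point of the sphere is reached
  (lemma range_sph), and the functions considered are periodic in the angles in the same way as
  the parametrization, so no restriction to a fundamental domain is needed.
\<close>

definition sph :: "real \<Rightarrow> real \<Rightarrow> real^3" where
  "sph \<theta> \<phi> = vector [sin \<theta> * cos \<phi>, sin \<theta> * sin \<phi>, cos \<theta>]"

definition f1 :: "real \<Rightarrow> real \<Rightarrow> real" where
  "f1 \<theta> \<phi> = sin \<theta> * cos \<phi>"

definition f2 :: "real \<Rightarrow> real \<Rightarrow> real" where
  "f2 \<theta> \<phi> = sin \<theta> * sin \<phi>"

definition f3 :: "real \<Rightarrow> real \<Rightarrow> real" where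
  "f3 \<theta> \<phi> = cos \<theta>"

definition zero_locus :: "(real \<Rightarrow> real \<Rightarrow> real) \<Rightarrow> (real^3) set" where
  "zero_locus F = {sph \<theta> \<phi> | \<theta> \<phi>. F \<theta> \<phi> = 0}"

definition great_circle :: "(real^3) set \<Rightarrow> bool" where
  "great_circle C \<longleftrightarrow> (\<exists>V. subspace V \<and> dim V = 2 \<and> C = sphere 0 1 \<inter> V)"

definition tangent_vectors :: "(real^3) set \<Rightarrow> real^3 \<Rightarrow> (real^3) set" where
  "tangent_vectors C p =
     {v. \<exists>(g :: real \<Rightarrow> real^3) e. 0 < e \<and> g 0 = p \<and> g ` {-e<..<e} \<subseteq> C \<and>
           g differentiable_on {-e<..<e} \<and> (g has_vector_derivative v) (at 0)}"

text \<open>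
  Orthogonality at p includes that both curves have a genuine tangent line (spanned by a nonzero
  vector) at p, so that it is never satisfied for lack of nonzero tangent vectors.
\<close>

definition orthogonal_at :: "(real^3) set \<Rightarrow> (real^3) set \<Rightarrow> real^3 \<Rightarrow> bool" where
  "orthogonal_at C D p \<longleftrightarrow>
     (\<exists>v w. v \<noteq> 0 \<and> w \<noteq> 0 \<and> tangent_vectors C p = span {v} \<and> tangent_vectors D p = span {w} \<and>
            v \<bullet> w = 0)"

definition meet_orthogonally :: "(real^3) set \<Rightarrow> (real^3) set \<Rightarrow> bool" where
  "meet_orthogonally C D \<longleftrightarrow> C \<inter> D \<noteq> {} \<and> (\<forall>p \<in> C \<inter> D. orthogonal_at C D p)"

lemma range_sph: "range (\<lambda>(\<theta>, \<phi>). sph \<theta> \<phi>) = sphere 0 1"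
proof (intro equalityI subsetI)
  fix p assume "p \<in> range (\<lambda>(\<theta>, \<phi>). sph \<theta> \<phi>)"
  then obtain \<theta> \<phi> where p: "p = sph \<theta> \<phi>" by auto
  have "sin \<theta> * cos \<phi> * (sin \<theta> * cos \<phi>) + sin \<theta> * sin \<phi> * (sin \<theta> * sin \<phi>) + cos \<theta> * cos \<theta> = 1"
    using sin_cos_squared_add[of \<theta>] sin_cos_squared_add[of \<phi>] unfolding power2_eq_square by algebra
  then have "p \<bullet> p = 1"
    by (simp add: p sph_def inner_vec_def sum_3)
  then show "p \<in> sphere 0 1" by (simp add: norm_eq_1)
next
  fix p :: "real^3" assume "p \<in> sphere 0 1"
  then have "p \<bullet> p = 1" by (simp add: norm_eq_1)
  then have *: "(p$1)\<^sup>2 + (p$2)\<^sup>2 + (p$3)\<^sup>2 = 1"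
    by (simp add: inner_vec_def sum_3 power2_eq_square)
  define r where "r = sqrt ((p$1)\<^sup>2 + (p$2)\<^sup>2)"
  have r2: "r\<^sup>2 = (p$1)\<^sup>2 + (p$2)\<^sup>2" by (simp add: r_def)
  obtain \<theta> where \<theta>: "p$3 = cos \<theta>" "r = sin \<theta>"
    using sincos_total_2pi[of "p$3" r] * r2 by (metis add.commute)
  obtain \<phi> where \<phi>: "p$1 = r * cos \<phi>" "p$2 = r * sin \<phi>"
  proof (cases "r = 0")
    case True
    then have "p$1 = 0" "p$2 = 0" using r2 by (simp_all add: sum_power2_eq_zero_iff)
    with True that show ?thesis by simp
  next
    case False
    then have "(p$1 / r)\<^sup>2 + (p$2 / r)\<^sup>2 = 1"
      by (simp add: power_divide r2[symmetric] add_divide_distrib[symmetric])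
    then obtain t where "p$1 / r = cos t" "p$2 / r = sin t"
      using sincos_total_2pi by metis
    with False that show ?thesis by (metis nonzero_mult_div_cancel_left times_divide_eq_right)
  qed
  have "p = sph \<theta> \<phi>"
    using \<theta> \<phi> by (simp add: sph_def vec_eq_iff forall_3)
  then show "p \<in> range (\<lambda>(\<theta>, \<phi>). sph \<theta> \<phi>)" by auto
qed

text \<open>
  The Euclidean inner product of the coordinate velocities gives
  ds^2 = d\<theta>^2 + sin^2 \<theta> d\<phi>^2.
\<close>

lemma induced_metric:
  fixes \<theta> \<phi> :: real
  defines "e\<theta> \<equiv> vector [cos \<theta> * cos \<phi>, cos \<theta> * sin \<phi>, - sin \<theta>] :: real^3"
    and "e\<phi> \<equiv> vector [- sin \<theta> * sin \<phi>, sin \<theta> * cos \<phi>, 0] :: real^3"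
  shows "((\<lambda>t. sph t \<phi>) has_vector_derivative e\<theta>) (at \<theta>)"
    and "((\<lambda>t. sph \<theta> t) has_vector_derivative e\<phi>) (at \<phi>)"
    and "(a *\<^sub>R e\<theta> + b *\<^sub>R e\<phi>) \<bullet> (c *\<^sub>R e\<theta> + d *\<^sub>R e\<phi>) = a * c + (sin \<theta>)\<^sup>2 * (b * d)"
proof -
  have vec: "((\<lambda>t. vector [x t, y t, z t] :: real^3) has_vector_derivative vector [x', y', z']) (at s)"
    if "(x has_real_derivative x') (at s)" "(y has_real_derivative y') (at s)"
      "(z has_real_derivative z') (at s)" for x y z x' y' z' s
  proof -
    have eq: "vector [u, v, w] = u *\<^sub>R axis 1 1 + v *\<^sub>R axis 2 1 + w *\<^sub>R (axis 3 1 :: real^3)" for u v w :: real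
      by (simp add: vec_eq_iff forall_3 axis_def)
    show ?thesis unfolding eq
      using that by (auto intro!: derivative_eq_intros)
  qed
  show "((\<lambda>t. sph t \<phi>) has_vector_derivative e\<theta>) (at \<theta>)"
    unfolding sph_def e\<theta>_def by (rule vec) (auto intro!: derivative_eq_intros)
  show "((\<lambda>t. sph \<theta> t) has_vector_derivative e\<phi>) (at \<phi>)"
    unfolding sph_def e\<phi>_def by (rule vec) (auto intro!: derivative_eq_intros)
  have s: "sin \<theta> * sin \<theta> = 1 - cos \<theta> * cos \<theta>" "sin \<phi> * sin \<phi> = 1 - cos \<phi> * cos \<phi>"
    using sin_cos_squared_add[of \<theta>] sin_cos_squared_add[of \<phi>] by (simp_all add: power2_eq_square)
  show "(a *\<^sub>R e\<theta> + b *\<^sub>R e\<phi>) \<bullet> (c *\<^sub>R e\<theta> + d *\<^sub>R e\<phi>) = a * c + (sin \<theta>)\<^sup>2 * (b * d)"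
    unfolding e\<theta>_def e\<phi>_def inner_vec_def sum_3 power2_eq_square
    apply simp
    using s by algebra
qed

end

theory Submission
  imports Defs
begin

text \<open>
  The function \<open>F\<^sub>i\<close> is the restriction to the sphere of the linear form \<open>x \<mapsto> a\<^sub>i \<bullet> x\<close>
  with \<open>a\<^sub>i = (X\<^sub>i, Y\<^sub>i, Z\<^sub>i) \<noteq> 0\<close>, so its zero locus is the section of the sphere by the
  plane \<open>a\<^sub>i\<^sup>\<bottom>\<close> (\<open>zero_locus_linear_form\<close>).  At a point \<open>p\<close> of this great circle the tangent
  vectors are the vectors orthogonal to both \<open>a\<^sub>i\<close> and \<open>p\<close> (\<open>tangent_vectors_plane_section\<close>).

  If \<open>a\<^sub>1 \<bullet> a\<^sub>2 = 0\<close> and \<open>p\<close> lies on both circles, then \<open>a\<^sub>1, a\<^sub>2, p\<close> is an orthogonal basis of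
  \<open>\<real>\<^sup>3\<close>.  Hence the tangent line of the first circle at \<open>p\<close> is spanned by \<open>a\<^sub>2\<close> and that of the
  second by \<open>a\<^sub>1\<close>: each circle runs in the direction of the normal of the other one
  (\<open>tangent_line_spanned_by_other_normal\<close>), and the orthogonality of the normals is the
  orthogonality of the tangents.  The circles do meet, because two vectors in \<open>\<real>\<^sup>3\<close> always have a
  common orthogonal unit vector.
\<close>

lemma linear_form_sph:
  "X * f1 \<theta> \<phi> + Y * f2 \<theta> \<phi> + Z * f3 \<theta> \<phi> = vector [X, Y, Z] \<bullet> sph \<theta> \<phi>"
  by (simp add: f1_def f2_def f3_def sph_def inner_vec_def sum_3)

lemma zero_locus_linear_form:
  "zero_locus (\<lambda>\<theta> \<phi>. a \<bullet> sph \<theta> \<phi>) = sphere 0 1 \<inter> {x. a \<bullet> x = 0}"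
  unfolding range_sph[symmetric] zero_locus_def by auto

lemma great_circle_plane_section:
  fixes a :: "real^3"
  assumes "a \<noteq> 0"
  shows "great_circle (sphere 0 1 \<inter> {x. a \<bullet> x = 0})"
  unfolding great_circle_def
  using subspace_hyperplane[of a] dim_hyperplane[OF assms] by auto

text \<open>
  Both quantities \<open>a \<bullet> g t\<close> and \<open>g t \<bullet> g t\<close> are constant along a curve \<open>g\<close> in the section, and
  differentiating them gives the two linear conditions.  Conversely, a nonzero vector \<open>v\<close>
  satisfying them is the velocity at \<open>p\<close> of the rotation with constant speed in the plane spanned
  by \<open>p\<close> and \<open>v\<close>, which lies in \<open>a\<^sup>\<bottom>\<close>.
\<close>

lemma tangent_vectors_plane_section:
  fixes a p :: "real^3"
  assumes p: "p \<in> sphere 0 1" "a \<bullet> p = 0"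
  shows "tangent_vectors (sphere 0 1 \<inter> {x. a \<bullet> x = 0}) p = {v. a \<bullet> v = 0 \<and> p \<bullet> v = 0}"
    (is "tangent_vectors ?C p = _")
proof (intro equalityI subsetI CollectI conjI)
  fix v assume "v \<in> tangent_vectors ?C p"
  then obtain g :: "real \<Rightarrow> real^3" and e where e: "0 < e" and g0: "g 0 = p"
    and gC: "g ` {-e<..<e} \<subseteq> ?C" and der: "(g has_vector_derivative v) (at 0)"
    unfolding tangent_vectors_def by blast
  have der': "(g has_derivative (\<lambda>h. h *\<^sub>R v)) (at 0)"
    using der by (simp add: has_vector_derivative_def)
  have near: "a \<bullet> g t = 0" "g t \<bullet> g t = 1" if "t \<in> {-e<..<e}" for t
  proof -
    have "g t \<in> ?C" using gC that by blast
    then show "a \<bullet> g t = 0" "g t \<bullet> g t = 1" by (simp_all add: norm_eq_1)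
  qed
  have const: "((\<lambda>_::real. c) has_derivative f') (at 0)"
    if "(h has_derivative f') (at 0)" "\<And>t. t \<in> {-e<..<e} \<Longrightarrow> h t = c" for h :: "real \<Rightarrow> real" and c f'
    using that e by (auto intro: has_derivative_transform_within_open[of h f' 0 UNIV "{-e<..<e}"])
  have "((\<lambda>t. a \<bullet> g t) has_derivative (\<lambda>h. a \<bullet> (h *\<^sub>R v))) (at 0)"
    using der' by (auto intro!: derivative_eq_intros)
  from has_derivative_unique[OF const[OF this near(1)] has_derivative_const]
  show "a \<bullet> v = 0" by (auto dest: fun_cong[of _ _ 1])
  have "((\<lambda>t. g t \<bullet> g t) has_derivative (\<lambda>h. g 0 \<bullet> (h *\<^sub>R v) + (h *\<^sub>R v) \<bullet> g 0)) (at 0)"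
    by (rule has_derivative_inner[OF der' der'])
  from has_derivative_unique[OF const[OF this near(2)] has_derivative_const]
  show "p \<bullet> v = 0" by (auto dest: fun_cong[of _ _ 1] simp: g0 inner_commute)
next
  fix v assume "v \<in> {v. a \<bullet> v = 0 \<and> p \<bullet> v = 0}"
  then have av: "a \<bullet> v = 0" and pv: "p \<bullet> v = 0" by auto
  define n where "n = norm v"
  \<comment> \<open>The angular velocity is \<open>n\<close>, so that the speed is that of \<open>v\<close>; for \<open>v = 0\<close> the curve is constant.\<close>
  define g where "g t = cos (t * n) *\<^sub>R p + (sin (t * n) * inverse n) *\<^sub>R v" for t
  have der: "(g has_vector_derivative
      - (sin (t * n) * n) *\<^sub>R p + (cos (t * n) * n * inverse n) *\<^sub>R v) (at t)" for t
    unfolding g_def by (auto intro!: derivative_eq_intros)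
  have nv: "(n * inverse n) *\<^sub>R v = v"
    by (cases "v = 0") (auto simp: n_def)
  have pp: "p \<bullet> p = 1" using p by (simp add: norm_eq_1)
  have vv: "v \<bullet> v = n * n" by (simp add: n_def dot_square_norm power2_eq_square)
  have "g t \<bullet> g t = (cos (t * n))\<^sup>2 + (sin (t * n))\<^sup>2 * (n * inverse n)\<^sup>2" for t
    unfolding g_def
    by (simp add: inner_add_left inner_add_right pp vv pv inner_commute[of v p] power2_eq_square)
  also have "\<dots> t = 1" for t by (cases "n = 0") auto
  finally have "g t \<in> ?C" for t
    using av p(2) by (simp add: norm_eq_1 g_def inner_add_right)
  moreover have "g differentiable_on {-1<..<1}"
    unfolding differentiable_on_def
    using der differentiableI_vector differentiable_at_withinI by blast
  moreover have "(g has_vector_derivative v) (at 0)" using der[of 0] nv by simp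
  moreover have "g 0 = p" by (simp add: g_def)
  ultimately show "v \<in> tangent_vectors ?C p"
    unfolding tangent_vectors_def by (intro CollectI exI[of _ g] exI[of _ 1]) auto
qed

text \<open>
  Three nonzero pairwise orthogonal vectors span \<open>\<real>\<^sup>3\<close>, so a vector orthogonal to two of them is a
  multiple of the third: subtracting its projection leaves a vector orthogonal to everything.
\<close>

lemma orthogonal_to_two_of_orthogonal_triple:
  fixes a b p :: "real^3"
  assumes nz: "a \<noteq> 0" "b \<noteq> 0" "p \<noteq> 0"
    and orth: "a \<bullet> b = 0" "a \<bullet> p = 0" "b \<bullet> p = 0"
  shows "{v. a \<bullet> v = 0 \<and> p \<bullet> v = 0} = span {b}"
proof (intro equalityI subsetI)
  fix v assume "v \<in> {v. a \<bullet> v = 0 \<and> p \<bullet> v = 0}"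
  then have v: "a \<bullet> v = 0" "p \<bullet> v = 0" by auto
  define u where "u = v - ((b \<bullet> v) / (b \<bullet> b)) *\<^sub>R b"
  have distinct: "a \<noteq> b" "a \<noteq> p" "b \<noteq> p" using nz orth by auto
  have "pairwise orthogonal {a, b, p}"
    using orth by (auto simp: pairwise_insert orthogonal_def inner_commute)
  then have "independent {a, b, p}"
    using nz by (intro pairwise_orthogonal_independent) auto
  then have "dim {a, b, p} = 3"
    using distinct by (simp add: dim_eq_card_independent)
  then have all: "span {a, b, p} = UNIV" by (simp add: dim_eq_full[symmetric])
  have "orthogonal u y" if "y \<in> {a, b, p}" for y
  proof -
    have "y \<bullet> u = 0"
      using that v orth nz unfolding u_def by (auto simp: inner_diff_right inner_commute[of p b])
    then show ?thesis by (simp add: orthogonal_def inner_commute)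
  qed
  then have "orthogonal u u"
    using orthogonal_to_span[of u "{a, b, p}" u] all by auto
  then have "v = ((b \<bullet> v) / (b \<bullet> b)) *\<^sub>R b" by (simp add: u_def orthogonal_def)
  then show "v \<in> span {b}" by (metis insertI1 span_base span_mul)
qed (use orth in \<open>auto simp: span_singleton inner_commute\<close>)

lemma tangent_line_spanned_by_other_normal:
  fixes a b p :: "real^3"
  assumes "a \<noteq> 0" "b \<noteq> 0" "a \<bullet> b = 0"
    and "p \<in> sphere 0 1" "a \<bullet> p = 0" "b \<bullet> p = 0"
  shows "tangent_vectors (sphere 0 1 \<inter> {x. a \<bullet> x = 0}) p = span {b}"
proof -
  have "p \<noteq> 0" using assms(4) by auto
  then show ?thesis
    using tangent_vectors_plane_section[of p a] orthogonal_to_two_of_orthogonal_triple[of a b p] assms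
    by metis
qed

lemma common_orthogonal_unit_vector:
  fixes a b :: "real^3"
  obtains p where "p \<in> sphere 0 1" "a \<bullet> p = 0" "b \<bullet> p = 0"
proof -
  have "dim {a, b} \<le> card {a, b}" by (rule dim_le_card') simp
  also have "\<dots> \<le> 2" by (simp add: card_insert_if)
  finally obtain x where x: "x \<noteq> 0" "\<And>y. y \<in> span {a, b} \<Longrightarrow> orthogonal x y"
    using orthogonal_to_subspace_exists[of "{a, b}"] by auto
  have "a \<bullet> x = 0" "b \<bullet> x = 0"
    using x(2)[of a] x(2)[of b] by (auto simp: orthogonal_def inner_commute span_base)
  with x(1) show thesis by (intro that[of "x /\<^sub>R norm x"]) auto
qed

lemma great_circles_with_orthogonal_normals_meet_orthogonally:
  fixes a b :: "real^3"
  assumes "a \<noteq> 0" "b \<noteq> 0" "a \<bullet> b = 0"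
  shows "meet_orthogonally (sphere 0 1 \<inter> {x. a \<bullet> x = 0}) (sphere 0 1 \<inter> {x. b \<bullet> x = 0})"
    (is "meet_orthogonally ?C ?D")
  unfolding meet_orthogonally_def
proof (intro conjI ballI)
  show "?C \<inter> ?D \<noteq> {}"
    using common_orthogonal_unit_vector[of a b] by blast
next
  fix p assume "p \<in> ?C \<inter> ?D"
  then have p: "p \<in> sphere 0 1" "a \<bullet> p = 0" "b \<bullet> p = 0" by auto
  have ba: "b \<bullet> a = 0" using assms(3) by (simp add: inner_commute)
  have "tangent_vectors ?C p = span {b}" "tangent_vectors ?D p = span {a}"
    using assms ba p by (simp_all only: tangent_line_spanned_by_other_normal not_False_eq_True)
  then show "orthogonal_at ?C ?D p"
    unfolding orthogonal_at_def using assms(1,2) ba by blast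
qed

theorem proposition1p3:
  fixes X1 Y1 Z1 X2 Y2 Z2 :: real
    and F1 F2 :: "real \<Rightarrow> real \<Rightarrow> real"
  assumes "F1 = (\<lambda>\<theta> \<phi>. X1 * f1 \<theta> \<phi> + Y1 * f2 \<theta> \<phi> + Z1 * f3 \<theta> \<phi>)"
    and "F2 = (\<lambda>\<theta> \<phi>. X2 * f1 \<theta> \<phi> + Y2 * f2 \<theta> \<phi> + Z2 * f3 \<theta> \<phi>)"
    and "F1 \<noteq> (\<lambda>\<theta> \<phi>. 0)" and "F2 \<noteq> (\<lambda>\<theta> \<phi>. 0)"
    and "X1 * X2 + Y1 * Y2 + Z1 * Z2 = 0"
  shows "great_circle (zero_locus F1) \<and> great_circle (zero_locus F2) \<and>
         meet_orthogonally (zero_locus F1) (zero_locus F2)"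
proof -
  define a :: "real^3" where "a = vector [X1, Y1, Z1]"
  define b :: "real^3" where "b = vector [X2, Y2, Z2]"
  have F: "F1 = (\<lambda>\<theta> \<phi>. a \<bullet> sph \<theta> \<phi>)" "F2 = (\<lambda>\<theta> \<phi>. b \<bullet> sph \<theta> \<phi>)"
    using assms(1,2) by (simp_all add: a_def b_def linear_form_sph)
  have "a \<noteq> 0" "b \<noteq> 0" using F assms(3,4) by auto
  moreover have "a \<bullet> b = 0"
    using assms(5) by (simp add: a_def b_def inner_vec_def sum_3)
  ultimately show ?thesis
    unfolding F zero_locus_linear_form
    by (simp add: great_circle_plane_section great_circles_with_orthogonal_normals_meet_orthogonally)
qed

end
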